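(* Let a POMDP have state set $S$, action set $A$ and observable signals $\Omega=O\times R$, and let $b_0$ be any initial probability distribution over $S$. Then there is a multiplicity automaton over $\mathbb{R}$ with alphabet $\Sigma=A\times\Omega$, of some size $r\le |S|$, whose computed function $f$ satisfies $f(w)=\mathbf{P}(w\mid b_0)$ for every test $w\in\Sigma^*$.
   Context: A POMDP consists of a finite state set $S=\{s_1,\dots,s_n\}$; a finite action set $A$; transition probabilities $P(s,a,s')$; a finite set of observable signals $\Omega=O\times R$, where $O$ is the observation set and $R\subset[0,1]$ is the set of immediate rewards; and observation probabilities $OB(o\mid s,a)$ for $o\in\Omega$. Write $\mathbf{P}(s',o\mid a,s)=OB(o\mid s,a)P(s,a,s')$. A test is a word over $\Sigma=A\times\Omega$, with $\lambda$ the empty word. Its success probability is given by $\mathbf{P}(\lambda\mid s)=1$, $\mathbf{P}((a,o)\circ t\mid s)=\sum_{s'\in S}\mathbf{P}(s',o\mid a,s)\,\mathbf{P}(t\mid s')$, and, for a distribution $b$ over $S$, $\mathbf{P}(t\mid b)=\sum_i b(i)\mathbf{P}(t\mid s_i)$. Here $\circ$ is concatenation. A multiplicity automaton of size $r$ over a field $K$ and an alphabet $\Sigma$ consists of matrices $\mu_\sigma\in K^{r\times r}$ ($\sigma\in\Sigma$) and a vector $\gamma\in K^r$. It defines $\mu(\lambda)=I$ and $\mu(\sigma_1\cdots\sigma_k)=\mu_{\sigma_1}\cdots\mu_{\sigma_k}$, and it computes the function $f(w)=[\mu(w)]_1\cdot\gamma$, where $[M]_1$ is the first row of $M$. *)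

theory Defs
  imports "Jordan_Normal_Form.Matrix"
begin

definition distribution_on :: "'x set \<Rightarrow> ('x \<Rightarrow> real) \<Rightarrow> bool" where
  "distribution_on X p \<longleftrightarrow> (\<forall>x\<in>X. 0 \<le> p x) \<and> (\<Sum>x\<in>X. p x) = 1"

(* P s a s' is P(s,a,s'); OB s a \<omega> is OB(\<omega> | s,a), where a signal \<omega> is a pair of an
   observation and an immediate reward. *)
locale pomdp =
  fixes S :: "'s set"
    and A :: "'a set"
    and Obs :: "'o set"
    and R :: "real set"
    and P :: "'s \<Rightarrow> 'a \<Rightarrow> 's \<Rightarrow> real"
    and OB :: "'s \<Rightarrow> 'a \<Rightarrow> 'o \<times> real \<Rightarrow> real"
  assumes finite_states: "finite S"
    and finite_actions: "finite A"
    and finite_signals: "finite (Obs \<times> R)"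
    and rewards: "R \<subseteq> {0..1}"
    and trans_distribution: "\<lbrakk>s \<in> S; a \<in> A\<rbrakk> \<Longrightarrow> distribution_on S (P s a)"
    and signal_distribution: "\<lbrakk>s \<in> S; a \<in> A\<rbrakk> \<Longrightarrow> distribution_on (Obs \<times> R) (OB s a)"
begin

definition joint_prob :: "'s \<Rightarrow> 'o \<times> real \<Rightarrow> 'a \<Rightarrow> 's \<Rightarrow> real" where
  "joint_prob s' \<omega> a s = OB s a \<omega> * P s a s'"

(* The success probability of a test started in state s. *)
fun test_prob :: "('a \<times> 'o \<times> real) list \<Rightarrow> 's \<Rightarrow> real" where
  "test_prob [] s = 1"
| "test_prob ((a, \<omega>) # t) s = (\<Sum>s'\<in>S. joint_prob s' \<omega> a s * test_prob t s')"

definition test_prob_from :: "('a \<times> 'o \<times> real) list \<Rightarrow> ('s \<Rightarrow> real) \<Rightarrow> real" where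
  "test_prob_from t b = (\<Sum>s\<in>S. b s * test_prob t s)"

end

record ('k, 'x) mult_automaton =
  ma_size :: nat
  ma_mat :: "'x \<Rightarrow> 'k mat"
  ma_vec :: "'k vec"

(* The size is positive because the computed function refers to the first row of a matrix. *)
definition multiplicity_automaton :: "'x set \<Rightarrow> ('k :: field, 'x) mult_automaton \<Rightarrow> bool" where
  "multiplicity_automaton \<Sigma> M \<longleftrightarrow>
     0 < ma_size M \<and>
     (\<forall>\<sigma>\<in>\<Sigma>. ma_mat M \<sigma> \<in> carrier_mat (ma_size M) (ma_size M)) \<and>
     ma_vec M \<in> carrier_vec (ma_size M)"

fun ma_word :: "('k :: field, 'x) mult_automaton \<Rightarrow> 'x list \<Rightarrow> 'k mat" where
  "ma_word M [] = 1\<^sub>m (ma_size M)"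
| "ma_word M (\<sigma> # w) = ma_mat M \<sigma> * ma_word M w"

(* Rows are indexed from 0, so row 0 is the first row. *)
definition ma_fun :: "('k :: field, 'x) mult_automaton \<Rightarrow> 'x list \<Rightarrow> 'k" where
  "ma_fun M w = row (ma_word M w) 0 \<bullet> ma_vec M"

end

theory Submission
  imports Defs "Jordan_Normal_Form.Determinant"
begin

text \<open>
  Indexed by the states, the one-step matrices \<open>T\<^sub>\<sigma>\<close> give
  \<open>\<^bold>P(\<sigma>\<^sub>1\<dots>\<sigma>\<^sub>k | b\<^sub>0) = b\<^sub>0 \<cdot> T\<^bsub>\<sigma>\<^sub>1\<^esub>\<cdots>T\<^bsub>\<sigma>\<^sub>k\<^esub> 1\<close>. An automaton always reads off its
  first row, so one changes the basis by an invertible \<open>Q\<close> with first row \<open>b\<^sub>0\<close> and uses the matrices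
  \<open>Q T\<^sub>\<sigma> Q\<^sup>-\<^sup>1\<close> and the vector \<open>Q 1\<close>. Listing first a state of positive initial probability makes such
  a \<open>Q\<close> available as the identity matrix with its first row replaced by \<open>b\<^sub>0\<close>, and no extra initial
  state is needed.
\<close>

lemma ma_word_carrier:
  assumes "multiplicity_automaton \<Sigma> M" "w \<in> lists \<Sigma>"
  shows "ma_word M w \<in> carrier_mat (ma_size M) (ma_size M)"
  using assms(2) by (induction w) (use assms(1) in \<open>auto simp: multiplicity_automaton_def\<close>)

text \<open>Associativity lets the product of a word act on the final vector one letter at a time,
  starting from the last. The recursion assumed of \<open>v\<close> then determines the
  result.\<close>

lemma ma_word_mult_vec:
  assumes M: "multiplicity_automaton \<Sigma> M"
    and "v [] = ma_vec M"
    and "\<And>\<sigma> w. \<sigma> \<in> \<Sigma> \<Longrightarrow> w \<in> lists \<Sigma> \<Longrightarrow> v (\<sigma> # w) = ma_mat M \<sigma> *\<^sub>v v w"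
    and "w \<in> lists \<Sigma>"
  shows "ma_word M w *\<^sub>v ma_vec M = v w"
  using assms(4)
proof (induction w)
  case Nil
  then show ?case
    using M assms(2) by (simp add: multiplicity_automaton_def)
next
  case (Cons \<sigma> w)
  then have *: "ma_mat M \<sigma> \<in> carrier_mat (ma_size M) (ma_size M)"
    "ma_vec M \<in> carrier_vec (ma_size M)"
    using M by (auto simp: multiplicity_automaton_def)
  have "w \<in> lists \<Sigma>"
    using Cons by simp
  from assoc_mult_mat_vec[OF *(1) ma_word_carrier[OF M this] *(2)] show ?case
    using Cons assms(3) by simp
qed

lemma ma_fun_eq_first_entry:
  assumes M: "multiplicity_automaton \<Sigma> M"
    and "v [] = ma_vec M"
    and "\<And>\<sigma> w. \<sigma> \<in> \<Sigma> \<Longrightarrow> w \<in> lists \<Sigma> \<Longrightarrow> v (\<sigma> # w) = ma_mat M \<sigma> *\<^sub>v v w"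
    and w: "w \<in> lists \<Sigma>"
  shows "ma_fun M w = v w $ 0"
proof -
  have "0 < dim_row (ma_word M w)"
    using M ma_word_carrier[OF M w] by (auto simp: multiplicity_automaton_def)
  then have "ma_fun M w = (ma_word M w *\<^sub>v ma_vec M) $ 0"
    by (simp add: ma_fun_def)
  then show ?thesis
    using ma_word_mult_vec[OF assms] by simp
qed

text \<open>The identity matrix with first row replaced by \<open>b\<close> is upper triangular with
  diagonal \<open>b $ 0\<close>, 1, ..., 1, so its determinant is \<open>b $ 0\<close>.\<close>

lemma left_invertible_mat_with_first_row:
  fixes b :: "'k :: field vec"
  assumes b: "b \<in> carrier_vec n" and "0 < n" and "b $ 0 \<noteq> 0"
  obtains Q Q' where "Q \<in> carrier_mat n n" "Q' \<in> carrier_mat n n" "row Q 0 = b" "Q' * Q = 1\<^sub>m n"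
proof -
  define Q where "Q = mat n n (\<lambda>(i, j). if i = 0 then b $ j else if i = j then 1 else 0)"
  have Q: "Q \<in> carrier_mat n n"
    by (simp add: Q_def)
  have "upper_triangular Q"
    by (auto simp: Q_def)
  moreover have "0 \<notin> set (diag_mat Q)"
    using assms by (auto simp: diag_mat_def Q_def split: if_splits)
  ultimately have "det Q \<noteq> 0"
    using det_upper_triangular[OF _ Q] by (simp add: prod_list_zero_iff)
  then obtain Q' where "Q' \<in> carrier_mat n n" "Q' * Q = 1\<^sub>m n"
    \<comment> \<open>\<open>?b\<close> only fills the extension slot of the record
      \<open>ring_mat\<close>, so any value serves.\<close>
    using det_non_zero_imp_unit[OF Q, where ?b = undefined]
    by (auto simp: Units_def ring_mat_def)
  moreover have "row Q 0 = b"
    using assms by (auto simp: Q_def)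
  ultimately show thesis
    using that Q by blast
qed

text \<open>In the new basis \<open>p w\<close> becomes \<open>Q *\<^sub>v p w\<close>, whose first
  entry is the product of the first row \<open>b\<close> of \<open>Q\<close> with
  \<open>p w\<close>.\<close>

lemma mult_automaton_of_linear_representation:
  fixes b :: "'k :: field vec"
  assumes b: "b \<in> carrier_vec n" "0 < n" "b $ 0 \<noteq> 0"
    and T: "\<And>\<sigma>. \<sigma> \<in> \<Sigma> \<Longrightarrow> T \<sigma> \<in> carrier_mat n n"
    and p: "\<And>w. w \<in> lists \<Sigma> \<Longrightarrow> p w \<in> carrier_vec n"
    and step: "\<And>\<sigma> w. \<sigma> \<in> \<Sigma> \<Longrightarrow> w \<in> lists \<Sigma> \<Longrightarrow> p (\<sigma> # w) = T \<sigma> *\<^sub>v p w"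
  shows "\<exists>M :: ('k, 'x) mult_automaton. multiplicity_automaton \<Sigma> M \<and> ma_size M = n \<and>
    (\<forall>w\<in>lists \<Sigma>. ma_fun M w = b \<bullet> p w)"
proof -
  obtain Q Q' where Q: "Q \<in> carrier_mat n n" "Q' \<in> carrier_mat n n"
    and row: "row Q 0 = b" and inv: "Q' * Q = 1\<^sub>m n"
    using left_invertible_mat_with_first_row[OF b] .
  define M where "M = \<lparr>ma_size = n, ma_mat = (\<lambda>\<sigma>. Q * T \<sigma> * Q'), ma_vec = Q *\<^sub>v p []\<rparr>"
  have M: "multiplicity_automaton \<Sigma> M"
    using Q T p[of "[]"] b(2) by (auto simp: multiplicity_automaton_def M_def)
  have "ma_fun M w = (Q *\<^sub>v p w) $ 0" if "w \<in> lists \<Sigma>" for w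
  proof (rule ma_fun_eq_first_entry[OF M _ _ that])
    show "Q *\<^sub>v p [] = ma_vec M"
      by (simp add: M_def)
  next
    fix \<sigma> w assume \<sigma>: "\<sigma> \<in> \<Sigma>" and w: "w \<in> lists \<Sigma>"
    \<comment> \<open>The brackets are moved so that \<open>Q'\<close> meets \<open>Q\<close> and
      cancels, leaving \<open>Q * T \<sigma>\<close> to act on \<open>p w\<close>.\<close>
    have "ma_mat M \<sigma> *\<^sub>v (Q *\<^sub>v p w) = (Q * T \<sigma>) *\<^sub>v (Q' *\<^sub>v (Q *\<^sub>v p w))"
      using assoc_mult_mat_vec[OF mult_carrier_mat[OF Q(1) T[OF \<sigma>]] Q(2)
          mult_mat_vec_carrier[OF Q(1) p[OF w]]]
      by (simp add: M_def)
    also have "Q' *\<^sub>v (Q *\<^sub>v p w) = p w"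
      using assoc_mult_mat_vec[OF Q(2,1) p[OF w]] inv one_mult_mat_vec[OF p[OF w]] by simp
    also have "(Q * T \<sigma>) *\<^sub>v p w = Q *\<^sub>v p (\<sigma> # w)"
      using assoc_mult_mat_vec[OF Q(1) T[OF \<sigma>] p[OF w]] step[OF \<sigma> w] by simp
    finally show "Q *\<^sub>v p (\<sigma> # w) = ma_mat M \<sigma> *\<^sub>v (Q *\<^sub>v p w)" ..
  qed
  moreover have "(Q *\<^sub>v p w) $ 0 = b \<bullet> p w" for w
    using Q b(2) row by simp
  ultimately show ?thesis
    using M by (intro exI[of _ M]) (simp add: M_def)
qed

text \<open>This serves to put a state of nonzero initial probability at index 0, where the change
  of basis needs a nonzero entry.\<close>

lemma enumeration_starting_at:
  assumes "finite S" "s \<in> S"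
  obtains g where "bij_betw g {0..<card S} S" "g 0 = s"
proof -
  obtain xs where "set xs = S - {s}" "distinct xs"
    using assms(1) finite_distinct_list by (metis finite_Diff)
  then have xs: "set (s # xs) = S" "distinct (s # xs)"
    using assms(2) by auto
  then have "bij_betw ((!) (s # xs)) {0..<card S} S"
    using distinct_card[OF xs(2)] by (intro bij_betw_nth) auto
  then show thesis
    using that by simp
qed

theorem corollary4p2:
  fixes S :: "'s set" and A :: "'a set" and Obs :: "'o set" and R :: "real set"
    and P :: "'s \<Rightarrow> 'a \<Rightarrow> 's \<Rightarrow> real"
    and OB :: "'s \<Rightarrow> 'a \<Rightarrow> 'o \<times> real \<Rightarrow> real"
    and b0 :: "'s \<Rightarrow> real"
  assumes "pomdp S A Obs R P OB"
    and "distribution_on S b0"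
  shows "\<exists>M :: (real, 'a \<times> 'o \<times> real) mult_automaton.
    multiplicity_automaton (A \<times> Obs \<times> R) M \<and> ma_size M \<le> card S \<and>
    (\<forall>w \<in> lists (A \<times> Obs \<times> R). ma_fun M w = pomdp.test_prob_from S P OB w b0)"
proof -
  interpret pomdp S A Obs R P OB
    by (fact assms(1))
  have "(\<Sum>s\<in>S. b0 s) \<noteq> 0"
    using assms(2) by (simp add: distribution_on_def)
  \<comment> \<open>A sum equal to 1 has a nonzero term; this also shows that there is a state, so
    the size is positive.\<close>
  then obtain s0 where s0: "s0 \<in> S" "b0 s0 \<noteq> 0"
    by (meson sum.neutral)
  obtain g where g: "bij_betw g {0..<card S} S" "g 0 = s0"
    using enumeration_starting_at[OF finite_states s0(1)] .
  have pos: "0 < card S"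
    using s0(1) finite_states by (auto simp: card_gt_0_iff)
  define b where "b = vec (card S) (\<lambda>i. b0 (g i))"
  \<comment> \<open>Rows stand for the current state and columns for the next one, so
    \<open>T \<sigma>\<close> acts on column vectors of success probabilities just as
    \<open>test_prob\<close> recurses.\<close>
  define T where "T = (\<lambda>(a, \<omega>). mat (card S) (card S) (\<lambda>(i, j). joint_prob (g j) \<omega> a (g i)))"
  define p where "p = (\<lambda>w. vec (card S) (\<lambda>i. test_prob w (g i)))"
  have "p (\<sigma> # w) = T \<sigma> *\<^sub>v p w" for \<sigma> w
    by (cases \<sigma>)
      (auto simp: p_def T_def scalar_prod_def simp flip: sum.reindex_bij_betw[OF g(1)])
  moreover have "b \<bullet> p w = test_prob_from w b0" for w
    by (simp add: b_def p_def scalar_prod_def test_prob_from_def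
        flip: sum.reindex_bij_betw[OF g(1)])
  moreover have "b \<in> carrier_vec (card S)" "b $ 0 \<noteq> 0"
    using pos g(2) s0(2) by (auto simp: b_def)
  moreover have "T \<sigma> \<in> carrier_mat (card S) (card S)" for \<sigma>
    by (cases \<sigma>) (simp add: T_def)
  moreover have "p w \<in> carrier_vec (card S)" for w
    by (simp add: p_def)
  ultimately show ?thesis
    using mult_automaton_of_linear_representation[of b "card S" "A \<times> Obs \<times> R" T p] pos by auto
qed

end
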